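(* Let $\ell>0$ be an integer and let $f(x)=x^\ell+a_1x^{\ell-1}+\cdots+a_\ell\in\mathbb{C}[x]$ be a monic complex polynomial of degree $\ell$. Then the following are equivalent: (a) $f(x)=A_\ell(x)$, the $\ell$-th Eulerian polynomial. (b) For every integer $m\geq 2$, \[ f(x^m)\equiv\left(\frac{1+x+\cdots+x^{m-1}}{m}\right)^{\ell+1}f(x)\mod (1-x)^{\ell+1}. \] (c) There exists an integer $m\geq 2$ such that \[ f(x^m)\equiv\left(\frac{1+x+\cdots+x^{m-1}}{m}\right)^{\ell+1}f(x)\mod (1-x)^{\ell+1}. \] (d) $f(x^2)\equiv\left(\frac{1+x}{2}\right)^{\ell+1}f(x)\mod (1-x)^{\ell+1}$.
   Context: For an integer $\ell\geq 1$, the Eulerian polynomial $A_\ell(x)$ is defined as the numerator of the rational function \[ \sum_{k=1}^\infty k^\ell x^k=\left(x\frac{d}{dx}\right)^\ell\frac{1}{1-x}=\frac{A_\ell(x)}{(1-x)^{\ell+1}}, \] i.e. $A_\ell(x)=(1-x)^{\ell+1}\sum_{k\geq 0}k^\ell x^k$; it is a monic polynomial of degree $\ell$ (e.g. $A_1=x$, $A_2=x+x^2$, $A_3=x+4x^2+x^3$). Congruences are in $\mathbb{C}[x]$: $p\equiv q \mod (1-x)^{\ell+1}$ means $(1-x)^{\ell+1}$ divides $p-q$. *)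

theory Defs
  imports "HOL-Computational_Algebra.Computational_Algebra" Complex_Main
begin

text \<open>
  The \<open>l\<close>-th Eulerian polynomial is the numerator of
  \<open>(\<Sum>k. k ^ l * x ^ k) = A\<^sub>l(x) / (1 - x) ^ (l + 1)\<close>, an identity of formal power series.
  The index \<open>k = 0\<close> contributes nothing when \<open>l \<ge> 1\<close>, the only case of interest; in HOL
  \<open>0 ^ 0 = 1\<close>, so that \<open>A\<^sub>0 = 1\<close>.  That the description is not vacuous is lemma
  \<open>fps_of_poly_eulerian_poly\<close>.
\<close>

definition eulerian_poly :: "nat \<Rightarrow> complex poly" where
  "eulerian_poly l = (THE p. fps_of_poly p =
     (1 - fps_X) ^ (l + 1) * Abs_fps (\<lambda>k. of_nat k ^ l))"

lemma eulerian_poly_exists: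
  "\<exists>p :: complex poly. fps_of_poly p = (1 - fps_X) ^ (l + 1) * Abs_fps (\<lambda>k. of_nat k ^ l)"
proof (induction l)
  case 0
  have "fps_of_poly (1 :: complex poly) = (1 - fps_X) * Abs_fps (\<lambda>_. 1)"
    by (simp add: fps_eq_iff algebra_simps)
  then show ?case by auto
next
  case (Suc l)
  define G :: "complex fps" where "G = Abs_fps (\<lambda>k. of_nat k ^ l)"
  obtain p where p: "fps_of_poly p = (1 - fps_X) ^ (l + 1) * G"
    using Suc.IH unfolding G_def by blast
  have G': "Abs_fps (\<lambda>k. of_nat k ^ Suc l) = fps_X * fps_deriv G"
  proof (rule fps_ext)
    fix n show "Abs_fps (\<lambda>k. of_nat k ^ Suc l) $ n = (fps_X * fps_deriv G) $ n"
      by (cases n) (auto simp: G_def)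
  qed
  let ?q = "[:0, 1:] * ([:1, -1:] * pderiv p + smult (of_nat (l + 1)) p)"
  have lin: "fps_of_poly [:1, -1 :: complex:] = 1 - fps_X"
    by (simp add: fps_of_poly_pCons)
  have dp: "fps_of_poly (pderiv p) =
      (1 - fps_X) ^ (l + 1) * fps_deriv G - of_nat (l + 1) * (1 - fps_X) ^ l * G"
    unfolding fps_of_poly_pderiv p
    by (simp only: fps_deriv_mult fps_deriv_power' fps_deriv_sub fps_deriv_1 fps_deriv_fps_X)
       (simp add: algebra_simps)
  have "fps_of_poly ?q = fps_X * ((1 - fps_X) * fps_of_poly (pderiv p) +
      of_nat (l + 1) * fps_of_poly p)"
    unfolding fps_of_poly_mult fps_of_poly_add fps_of_poly_smult fps_of_nat lin
    by (simp add: fps_of_poly_pCons algebra_simps)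
  also have "\<dots> = (1 - fps_X) ^ (Suc l + 1) * (fps_X * fps_deriv G)"
    unfolding dp p by (simp add: algebra_simps)
  finally show ?case unfolding G' by blast
qed

lemma fps_of_poly_eulerian_poly:
  "fps_of_poly (eulerian_poly l) = (1 - fps_X) ^ (l + 1) * Abs_fps (\<lambda>k. of_nat k ^ l)"
  unfolding eulerian_poly_def
  by (rule theI') (metis eulerian_poly_exists fps_of_poly_eq_iff)

definition power_cong :: "nat \<Rightarrow> nat \<Rightarrow> complex poly \<Rightarrow> bool" where
  "power_cong l m f \<longleftrightarrow>
     [:1, -1:] ^ (l + 1) dvd
       f \<circ>\<^sub>p monom 1 m - smult (1 / of_nat m) (\<Sum>i<m. monom 1 i) ^ (l + 1) * f"

end

theory Submission
  imports Defs
begin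

text \<open>
  Put \<open>S = 1 + x + \<dots> + x ^ (m - 1)\<close>, so that \<open>(1 - x) S = 1 - x ^ m\<close>.  That the Eulerian polynomials
  satisfy the congruence is shown by induction on \<open>l\<close> from the recurrence
  \<open>A\<^sub>l\<^sub>+\<^sub>1 = x ((1 - x) A\<^sub>l' + (l + 1) A\<^sub>l)\<close>: if
  \<open>m ^ (l + 1) A\<^sub>l(x ^ m) - S ^ (l + 1) A\<^sub>l = (1 - x) ^ (l + 1) Q\<close>, then the same difference for
  \<open>l + 1\<close> is \<open>(1 - x) ^ (l + 2) x (S Q' - (l + 1) S' Q)\<close>.

  Conversely, if \<open>g = (x - 1) ^ k h\<close> with \<open>h(1) \<noteq> 0\<close> and \<open>1 \<le> k \<le> l\<close>, then
  \<open>g(x ^ m) - (S / m) ^ (l + 1) g\<close> equals \<open>(x - 1) ^ k\<close> times a polynomial with value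
  \<open>(m ^ k - 1) h(1) \<noteq> 0\<close> at \<open>1\<close>.  Hence a solution of the congruence of degree at most \<open>l\<close> that vanishes
  at \<open>1\<close> is zero, the solutions of degree at most \<open>l\<close> are the multiples of \<open>A\<^sub>l\<close>, and the
  only monic one is \<open>A\<^sub>l\<close>.
\<close>

lemma eulerian_poly_0: "eulerian_poly 0 = 1"
proof -
  have "fps_of_poly (eulerian_poly 0) = fps_of_poly 1"
    unfolding fps_of_poly_eulerian_poly by (simp add: fps_eq_iff algebra_simps)
  then show ?thesis by (simp only: fps_of_poly_eq_iff)
qed

text \<open>The operator x d/dx multiplies the k-th coefficient by k, so it takes the series for
  \<open>l\<close> to the one for \<open>l + 1\<close>. Differentiating
  \<open>(1 - fps_X) ^ (l + 1) * G\<close> gives the rest.\<close>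

lemma eulerian_poly_Suc:
  "eulerian_poly (Suc l) =
     [:0, 1:] * ([:1, -1:] * pderiv (eulerian_poly l) + of_nat (l + 1) * eulerian_poly l)"
    (is "_ = ?q")
proof -
  define G :: "complex fps" where "G = Abs_fps (\<lambda>k. of_nat k ^ l)"
  have p: "fps_of_poly (eulerian_poly l) = (1 - fps_X) ^ (l + 1) * G"
    unfolding G_def by (rule fps_of_poly_eulerian_poly)
  have G': "Abs_fps (\<lambda>k. of_nat k ^ Suc l) = fps_X * fps_deriv G"
  proof (rule fps_ext)
    fix n show "Abs_fps (\<lambda>k. of_nat k ^ Suc l) $ n = (fps_X * fps_deriv G) $ n"
      by (cases n) (auto simp: G_def)
  qed
  have lin: "fps_of_poly [:1, -1 :: complex:] = 1 - fps_X"
    by (simp add: fps_of_poly_pCons)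
  have dp: "fps_of_poly (pderiv (eulerian_poly l)) =
      (1 - fps_X) ^ (l + 1) * fps_deriv G - of_nat (l + 1) * (1 - fps_X) ^ l * G"
    unfolding fps_of_poly_pderiv p
    by (simp only: fps_deriv_mult fps_deriv_power' fps_deriv_sub fps_deriv_1 fps_deriv_fps_X)
       (simp add: algebra_simps)
  have "fps_of_poly ?q = fps_X * ((1 - fps_X) * fps_of_poly (pderiv (eulerian_poly l)) +
      of_nat (l + 1) * fps_of_poly (eulerian_poly l))"
    unfolding fps_of_poly_mult fps_of_poly_add lin of_nat_poly fps_of_poly_const fps_of_nat
    by (simp add: fps_of_poly_pCons algebra_simps)
  also have "\<dots> = (1 - fps_X) ^ (Suc l + 1) * (fps_X * fps_deriv G)"
    unfolding dp p by (simp add: algebra_simps)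
  also have "\<dots> = fps_of_poly (eulerian_poly (Suc l))"
    unfolding fps_of_poly_eulerian_poly G' ..
  finally show ?thesis by (simp only: fps_of_poly_eq_iff)
qed

text \<open>Compare coefficients in the recurrence: at the top index the factor
  \<open>(l + 1) - i\<close> with \<open>i = l\<close> is 1, so the leading coefficient is
  preserved.\<close>

lemma degree_eulerian_poly_le: "degree (eulerian_poly l) \<le> l"
  and coeff_eulerian_poly_self: "coeff (eulerian_poly l) l = 1"
proof -
  have "degree (eulerian_poly l) \<le> l \<and> coeff (eulerian_poly l) l = 1"
  proof (induction l)
    case 0
    then show ?case by (simp add: eulerian_poly_0)
  next
    case (Suc l)
    have vanish: "coeff (eulerian_poly l) i = 0" if "i > l" for i
      using Suc that by (auto intro: coeff_eq_0)
    have rec: "coeff (eulerian_poly (Suc l)) (Suc i) =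
        of_nat (Suc i) * coeff (eulerian_poly l) (Suc i) +
        of_nat (l + 1) * coeff (eulerian_poly l) i - of_nat i * coeff (eulerian_poly l) i" for i
      unfolding eulerian_poly_Suc
      by (cases i) (simp_all add: coeff_pderiv of_nat_poly algebra_simps)
    have "coeff (eulerian_poly (Suc l)) i = 0" if "i > Suc l" for i
      using that vanish rec by (cases i) auto
    moreover have "coeff (eulerian_poly (Suc l)) (Suc l) = 1"
      using Suc vanish unfolding rec by (simp add: algebra_simps)
    ultimately show ?case by (auto intro: degree_le)
  qed
  then show "degree (eulerian_poly l) \<le> l" and "coeff (eulerian_poly l) l = 1"
    by auto
qed

lemma pcompose_power: "p ^ n \<circ>\<^sub>p q = (p \<circ>\<^sub>p q :: 'a :: comm_semiring_1 poly) ^ n"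
  by (induction n) (simp_all add: pcompose_1 pcompose_mult)

lemma one_minus_X_times_geometric_sum:
  "[:1, -1:] * (\<Sum>i<m. monom 1 i) = (1 - monom 1 m :: 'a :: comm_ring_1 poly)"
  by (induction m)
     (simp_all add: algebra_simps monom_Suc monom_0 flip: one_pCons)

lemma poly_geometric_sum_1 [simp]:
  "poly (\<Sum>i<m. monom 1 i) (1 :: 'a :: comm_semiring_1) = of_nat m"
  by (simp add: poly_sum poly_monom)

lemma eulerian_poly_cong:
  "[:1, -1:] ^ (l + 1) dvd
     of_nat m ^ (l + 1) * (eulerian_poly l \<circ>\<^sub>p monom 1 m) -
     (\<Sum>i<m. monom 1 i) ^ (l + 1) * eulerian_poly l"
proof (induction l)
  case 0
  have "[:- 1, 1:] dvd (of_nat m - (\<Sum>i<m. monom 1 i) :: complex poly)"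
    by (simp flip: poly_eq_0_iff_dvd)
  moreover have "[:1, -1:] dvd ([:- 1, 1:] :: complex poly)"
    by (rule dvdI[of _ _ "-1"]) simp
  ultimately show ?case
    by (simp add: eulerian_poly_0 pcompose_1 dvd_trans)
next
  case (Suc l)
  define X :: "complex poly" where "X = [:0, 1:]"
  define c :: "complex poly" where "c = [:1, -1:]"
  define M :: "complex poly" where "M = monom 1 m"
  define S :: "complex poly" where "S = (\<Sum>i<m. monom 1 i)"
  define N :: "complex poly" where "N = of_nat (l + 1)"
  define A where "A = eulerian_poly l"
  define B where "B = A \<circ>\<^sub>p M"
  obtain Q where Q: "of_nat m ^ (l + 1) * B - S ^ (l + 1) * A = c ^ (l + 1) * Q"
    using Suc unfolding A_def B_def M_def S_def c_def dvd_def by auto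
  have cS: "c * S = 1 - M"
    unfolding c_def S_def M_def by (rule one_minus_X_times_geometric_sum)
  have dc: "pderiv c = -1"
    by (simp add: c_def pderiv_pCons one_pCons)
  \<comment> \<open>This comes from differentiating \<open>cS\<close>.\<close>
  have dM: "pderiv M = S - c * pderiv S"
    using arg_cong[OF cS, of pderiv] by (simp add: pderiv_mult pderiv_diff dc algebra_simps)
  \<comment> \<open>With the chain rule, this turns
    \<open>of_nat m * M * (pderiv A \<circ>\<^sub>p M)\<close> into
    \<open>X * pderiv B\<close>.\<close>
  have XdM: "of_nat m * M = X * pderiv M"
    by (cases m) (simp_all add: M_def X_def pderiv_monom of_nat_poly smult_monom flip: monom_Suc)
  have B: "of_nat m ^ (l + 1) * B = S ^ (l + 1) * A + c ^ (l + 1) * Q"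
    using Q by (simp add: algebra_simps)
  have "pderiv (of_nat m ^ (l + 1) :: complex poly) = 0"
    by (simp only: of_nat_poly poly_const_pow) simp
  then have dB: "of_nat m ^ (l + 1) * pderiv B =
      N * S ^ l * pderiv S * A + S ^ (l + 1) * pderiv A -
      N * c ^ l * Q + c ^ (l + 1) * pderiv Q"
    using arg_cong[OF B, of pderiv]
    by (simp add: pderiv_mult pderiv_add pderiv_power_Suc dc N_def of_nat_poly algebra_simps
        del: power_Suc)
  have "of_nat m * (eulerian_poly (Suc l) \<circ>\<^sub>p M) =
      of_nat m * M * (c * S * (pderiv A \<circ>\<^sub>p M) + N * B)"
    unfolding eulerian_poly_Suc cS
    by (simp add: pcompose_mult pcompose_add pcompose_uminus pcompose_smult pcompose_pCons A_def B_def
        N_def of_nat_poly one_pCons smult_add_left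
        algebra_simps)
  also have "\<dots> = X * (c * S * pderiv B + N * pderiv M * B)"
    unfolding XdM by (simp add: B_def pderiv_pcompose algebra_simps)
  finally have "of_nat m ^ (l + 1) * (of_nat m * (eulerian_poly (Suc l) \<circ>\<^sub>p M)) =
      X * (c * S * (of_nat m ^ (l + 1) * pderiv B) +
           N * pderiv M * (of_nat m ^ (l + 1) * B))"
    by (simp add: algebra_simps)
  \<comment> \<open>All terms in \<open>A\<close> cancel. Of the terms in \<open>Q\<close>, the two
    with only \<open>c ^ (l + 1)\<close>, namely \<open>X * N * S * c ^ (l + 1) * Q\<close> with
    opposite signs, cancel as well; this gains the extra factor \<open>c\<close>.\<close>
  also have "\<dots> - S ^ (Suc l + 1) * (X * (c * pderiv A + N * A)) =
      c ^ (Suc l + 1) * (X * (S * pderiv Q - N * pderiv S * Q))"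
    unfolding B dB dM by (simp add: algebra_simps)
  finally have "of_nat m ^ (Suc l + 1) * (eulerian_poly (Suc l) \<circ>\<^sub>p M) -
      S ^ (Suc l + 1) * eulerian_poly (Suc l) =
      c ^ (Suc l + 1) * (X * (S * pderiv Q - N * pderiv S * Q))"
    unfolding eulerian_poly_Suc X_def c_def A_def N_def by (simp add: algebra_simps)
  then show ?case
    unfolding M_def S_def c_def by (metis dvd_triv_left)
qed

lemma power_cong_eulerian_poly:
  assumes "m > 0"
  shows "power_cong l m (eulerian_poly l)"
proof -
  have "(of_nat m ^ (l + 1) :: complex poly) = [:of_nat m ^ (l + 1):]"
    by (simp only: of_nat_poly poly_const_pow)
  then have "eulerian_poly l \<circ>\<^sub>p monom 1 m -
      smult (1 / of_nat m) (\<Sum>i<m. monom 1 i) ^ (l + 1) * eulerian_poly l =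
    smult (1 / of_nat m ^ (l + 1))
      (of_nat m ^ (l + 1) * (eulerian_poly l \<circ>\<^sub>p monom 1 m) -
       (\<Sum>i<m. monom 1 i) ^ (l + 1) * eulerian_poly l)"
    using assms
    by (simp add: smult_diff_right smult_power power_one_over del: power_Suc)
  then show ?thesis
    unfolding power_cong_def by (metis dvd_smult eulerian_poly_cong)
qed

text \<open>Both sides of the congruence are linear in the polynomial.\<close>

lemma power_cong_diff_smult:
  assumes "power_cong l m f" "power_cong l m g"
  shows "power_cong l m (f - smult a g)"
proof -
  let ?W = "smult (1 / of_nat m) (\<Sum>i<m. monom 1 i) ^ (l + 1) :: complex poly"
  have "(f - smult a g) \<circ>\<^sub>p monom 1 m - ?W * (f - smult a g) =
      (f \<circ>\<^sub>p monom 1 m - ?W * f) - smult a (g \<circ>\<^sub>p monom 1 m - ?W * g)"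
    by (simp add: pcompose_diff pcompose_smult smult_diff_right right_diff_distrib)
  then show ?thesis
    using assms unfolding power_cong_def by (simp add: dvd_diff dvd_smult)
qed

lemma power_cong_imp_eq_0:
  assumes "m \<ge> 2" "power_cong l m g" "degree g \<le> l" "poly g 1 = 0"
  shows "g = 0"
proof (rule ccontr)
  assume "g \<noteq> 0"
  define k where "k = order 1 g"
  define c :: "complex poly" where "c = [:1, -1:]"
  define S :: "complex poly" where "S = (\<Sum>i<m. monom 1 i)"
  obtain h0 where h0: "g = [:- 1, 1:] ^ k * h0" "\<not> [:- 1, 1:] dvd h0"
    using order_decomp[OF \<open>g \<noteq> 0\<close>, of 1] unfolding k_def by auto
  \<comment> \<open>\<open>order\<close> counts factors x - 1, the congruence uses 1 - x; the sign
    moves into \<open>h\<close>.\<close>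
  define h where "h = (-1) ^ k * h0"
  have "[:- 1, 1:] = - c"
    by (simp add: c_def)
  then have g: "g = c ^ k * h"
    using h0(1) unfolding h_def by (metis mult.assoc mult.commute power_minus)
  have "poly h 1 \<noteq> 0"
    using h0(2) by (simp add: h_def flip: poly_eq_0_iff_dvd)
  have "k > 0"
    using assms(4) \<open>g \<noteq> 0\<close> by (simp add: k_def order_root)
  have "k \<le> l"
    using order_degree[OF \<open>g \<noteq> 0\<close>, of 1] assms(3) by (simp add: k_def)
  define R where "R = S ^ k * (h \<circ>\<^sub>p monom 1 m) - smult (1 / of_nat m) S ^ (l + 1) * h"
  have "c \<circ>\<^sub>p monom 1 m = c * S"
    unfolding c_def S_def one_minus_X_times_geometric_sum
    by (simp add: pcompose_pCons one_pCons)
  then have "g \<circ>\<^sub>p monom 1 m - smult (1 / of_nat m) S ^ (l + 1) * g = c ^ k * R"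
    by (simp add: g R_def pcompose_mult pcompose_power power_mult_distrib algebra_simps)
  then have "c ^ (l + 1) dvd c ^ k * R"
    using assms(2) by (simp add: power_cong_def c_def S_def)
  \<comment> \<open>Since k \<le> l, at least one factor \<open>c\<close> survives the cancellation
    of \<open>c ^ k\<close>.\<close>
  then have "c ^ k * c dvd c ^ k * R"
    using \<open>k \<le> l\<close> le_imp_power_dvd[of "k + 1" "l + 1" c]
    by (metis Suc_eq_plus1 Suc_le_mono dvd_trans power_Suc2)
  moreover have "c ^ k \<noteq> 0"
    by (simp add: c_def)
  ultimately have "c dvd R"
    by (simp only: dvd_mult_cancel_left) simp
  then have "poly R 1 = 0"
    by (auto simp: c_def)
  \<comment> \<open>At 1, \<open>S\<close> has value \<open>m\<close>, so the factor
    \<open>smult (1 / of_nat m) S\<close> becomes 1.\<close>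
  then have "of_nat m ^ k * poly h 1 = poly h 1"
    using assms(1) by (simp add: R_def S_def poly_pcompose poly_monom)
  then have "(of_nat (m ^ k) :: complex) = of_nat 1"
    using \<open>poly h 1 \<noteq> 0\<close> by simp
  then have "m ^ k = 1"
    unfolding of_nat_eq_iff .
  then show False
    using assms(1) \<open>k > 0\<close> by simp
qed

lemma eulerian_poly_unique:
  assumes "m \<ge> 2" "power_cong l m f" "degree f = l" "lead_coeff f = 1"
  shows "f = eulerian_poly l"
proof -
  define A where "A = eulerian_poly l"
  have A: "power_cong l m A" "degree A \<le> l" "coeff A l = 1"
    using assms(1) power_cong_eulerian_poly degree_eulerian_poly_le coeff_eulerian_poly_self
    by (simp_all add: A_def)
  \<comment> \<open>Otherwise \<open>A\<close> would be zero, against its coefficient 1 at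
    \<open>l\<close>.\<close>
  have "poly A 1 \<noteq> 0"
    using power_cong_imp_eq_0[OF assms(1) A(1,2)] A(3) by auto
  \<comment> \<open>This scalar makes \<open>f - smult a A\<close> vanish at 1.\<close>
  define a where "a = poly f 1 / poly A 1"
  have "f - smult a A = 0"
  proof (rule power_cong_imp_eq_0[OF assms(1)])
    show "power_cong l m (f - smult a A)"
      using assms(2) A(1) by (rule power_cong_diff_smult)
    show "degree (f - smult a A) \<le> l"
      using assms(3) A(2) by (intro degree_diff_le) auto
    show "poly (f - smult a A) 1 = 0"
      using \<open>poly A 1 \<noteq> 0\<close> by (simp add: a_def)
  qed
  then have f: "f = smult a A" by simp
  then have "a = 1"
    using assms(3,4) A(3) by (metis coeff_smult mult.right_neutral)
  then show ?thesis using f by (simp add: A_def)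
qed

theorem theorem5p1:
  fixes l :: nat and f :: "complex poly"
  assumes "l > 0" and "degree f = l" and "lead_coeff f = 1"
  shows "(f = eulerian_poly l \<longleftrightarrow> (\<forall>m\<ge>2. power_cong l m f)) \<and>
         (f = eulerian_poly l \<longleftrightarrow> (\<exists>m\<ge>2. power_cong l m f)) \<and>
         (f = eulerian_poly l \<longleftrightarrow>
            [:1, -1:] ^ (l + 1) dvd f \<circ>\<^sub>p [:0, 0, 1:] - smult (1 / 2) [:1, 1:] ^ (l + 1) * f)"
proof -
  have "monom 1 2 = [:0, 0, 1 :: complex:]" "(\<Sum>i<2. monom 1 i) = [:1, 1 :: complex:]"
    by (simp_all add: numeral_2_eq_2 monom_Suc monom_0 one_pCons)
  then have d: "power_cong l 2 f \<longleftrightarrow>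
      [:1, -1:] ^ (l + 1) dvd f \<circ>\<^sub>p [:0, 0, 1:] - smult (1 / 2) [:1, 1:] ^ (l + 1) * f"
    by (simp add: power_cong_def)
  \<comment> \<open>Each single m \<ge> 2 already characterises the Eulerian polynomial; m = 2
    supplies the instance for the universal, the existential and the explicit condition.\<close>
  have "power_cong l m f \<longleftrightarrow> f = eulerian_poly l" if "m \<ge> 2" for m
    using eulerian_poly_unique[OF that _ assms(2,3)] power_cong_eulerian_poly[of m l] that by auto
  then show ?thesis
    unfolding d[symmetric] by (metis order_refl)
qed

end
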